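(* Let $v$ be a positive even integer and let $(A,B)$ be a periodic Golay pair of length $v$, with $a=\sum_i a_i$ and $b=\sum_i b_i$ the sums of the entries of $A$ and $B$. Suppose that either no prime $p\equiv 1\pmod 4$ divides $v/2$, or exactly one prime $p\equiv1\pmod 4$ divides $v/2$ and it divides $v/2$ exactly once ($p\,\|\,v/2$). Then the $(v/2)$-compression $(A^{(v/2)},B^{(v/2)})$ of $(A,B)$ is equivalent to either $([0,a],[0,b])$ or $\bigl([\tfrac{a+b}{2},\tfrac{a-b}{2}],[\tfrac{a+b}{2},\tfrac{b-a}{2}]\bigr)$.
   Context: A periodic Golay pair of length $v$ is a pair of sequences $A=[a_0,\dots,a_{v-1}]$, $B=[b_0,\dots,b_{v-1}]$ with all entries in $\{-1,+1\}$ such that $\mathrm{PAF}(A,s)+\mathrm{PAF}(B,s)=0$ for $s=1,\dots,v/2$, where $\mathrm{PAF}(A,s)=\sum_{k=0}^{v-1}a_ka_{k+s}$ with indices modulo $v$. For a positive divisor $m$ of $v$, the $m$-compression of $A$ is the length-$v/m$ sequence $A^{(m)}$ with entries $a^{(m)}_k=\sum_{j=0}^{m-1}a_{k+j\,v/m}$; the $m$-compression of $(A,B)$ is $(A^{(m)},B^{(m)})$. Equivalence of pairs $(X,Y)$ of integer sequences of a common length $n$ is the equivalence relation generated by the operations: swapping $X$ and $Y$; cyclically shifting the entries of one of the sequences; reversing one of the sequences; decimation, replacing $x_i$ by $x_{ki \bmod n}$ and $y_i$ by $y_{ki\bmod n}$ for some $k$ coprime to $n$; alternating negation, replacing $x_i$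 by $(-1)^ix_i$ and $y_i$ by $(-1)^iy_i$ (the negation of one sequence is obtainable from these). *)

theory Defs
  imports Main "HOL-Computational_Algebra.Primes" "HOL-Number_Theory.Cong"
begin

definition PAF :: "int list \<Rightarrow> nat \<Rightarrow> int" where
  "PAF A s = (\<Sum>k<length A. A ! k * A ! ((k + s) mod length A))"

definition periodic_Golay_pair :: "nat \<Rightarrow> int list \<Rightarrow> int list \<Rightarrow> bool" where
  "periodic_Golay_pair v A B \<longleftrightarrow>
     length A = v \<and> length B = v \<and>
     set A \<subseteq> {-1, 1} \<and> set B \<subseteq> {-1, 1} \<and>
     (\<forall>s\<in>{1..v div 2}. PAF A s + PAF B s = 0)"

text \<open>Meaningful when \<open>m\<close> is a positive divisor of the length.\<close>
definition compression :: "nat \<Rightarrow> int list \<Rightarrow> int list" where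
  "compression m A =
     map (\<lambda>k. \<Sum>j<m. A ! (k + j * (length A div m))) [0..<length A div m]"

definition decimate :: "nat \<Rightarrow> int list \<Rightarrow> int list" where
  "decimate k X = map (\<lambda>i. X ! (k * i mod length X)) [0..<length X]"

definition alternate :: "int list \<Rightarrow> int list" where
  "alternate X = map (\<lambda>i. (-1) ^ i * X ! i) [0..<length X]"

inductive pair_op :: "int list \<times> int list \<Rightarrow> int list \<times> int list \<Rightarrow> bool" where
  swap: "length X = length Y \<Longrightarrow> pair_op (X, Y) (Y, X)"
| shift_fst: "length X = length Y \<Longrightarrow> pair_op (X, Y) (rotate r X, Y)"
| shift_snd: "length X = length Y \<Longrightarrow> pair_op (X, Y) (X, rotate r Y)"
| reverse_fst: "length X = length Y \<Longrightarrow> pair_op (X, Y) (rev X, Y)"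
| reverse_snd: "length X = length Y \<Longrightarrow> pair_op (X, Y) (X, rev Y)"
| decimation: "length X = length Y \<Longrightarrow> coprime k (length X) \<Longrightarrow>
    pair_op (X, Y) (decimate k X, decimate k Y)"
| alternation: "length X = length Y \<Longrightarrow> pair_op (X, Y) (alternate X, alternate Y)"

definition pair_equivalent :: "int list \<times> int list \<Rightarrow> int list \<times> int list \<Rightarrow> bool" where
  "pair_equivalent = equivclp pair_op"

lemma even_sum_list_pm1:
  assumes "set A \<subseteq> {-1, 1::int}"
  shows "even (sum_list A) \<longleftrightarrow> even (length A)"
  using assms by (induction A) auto

text \<open>Hence \<open>div 2\<close> is exact on sums and differences of the two entry sums for a pair of even length.\<close>
lemma periodic_Golay_pair_even_sums:
  assumes "periodic_Golay_pair v A B" "even v"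
  shows "even (sum_list A)" "even (sum_list B)"
  using assms even_sum_list_pm1 unfolding periodic_Golay_pair_def by metis+

end

theory Submission
  imports Defs "HOL-Number_Theory.Residues"
begin

text \<open>Writing the \<open>v/2\<close>-compression as \<open>([x\<^sub>0, x\<^sub>1], [y\<^sub>0, y\<^sub>1])\<close>, the vanishing autocorrelations
  evaluated at the characters \<open>k \<mapsto> 1\<close> and \<open>k \<mapsto> (-1)^k\<close> give
  \<open>(x\<^sub>0 + x\<^sub>1)\<^sup>2 + (y\<^sub>0 + y\<^sub>1)\<^sup>2 = 2 v = (x\<^sub>0 - x\<^sub>1)\<^sup>2 + (y\<^sub>0 - y\<^sub>1)\<^sup>2\<close>.
  Under the hypothesis on \<open>v/2\<close>, an integer \<open>2 v\<close> is a sum of two squares in at most one way up to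
  order and signs: factors \<open>2\<close> and prime factors \<open>q \<equiv> 3 (mod 4)\<close> can be removed by descent, leaving
  \<open>1\<close> or a single prime. Matching the squares in either order yields the two normal forms up to
  cyclic shifts.\<close>

section \<open>Uniqueness of sums of two squares\<close>

text \<open>In effect -1 is a non-residue modulo \<open>q\<close>: raising a^2 = -b^2 to the odd
  power (q - 1)/2 and applying Fermat would give 1 = -1 modulo \<open>q\<close>.\<close>

lemma prime_3_mod_4_dvd_sum_squares:
  fixes a b :: int and q :: nat
  assumes q: "prime q" "q mod 4 = 3" and d: "int q dvd a\<^sup>2 + b\<^sup>2"
  shows "int q dvd a"
proof (rule ccontr)
  assume na: "\<not> int q dvd a"
  have pq: "prime (int q)" using q by simp
  have nb: "\<not> int q dvd b"
  proof
    assume "int q dvd b"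
    then have "int q dvd b\<^sup>2" by (simp add: power2_eq_square)
    with d have "int q dvd a\<^sup>2" by (simp add: dvd_add_left_iff)
    with pq na show False by (simp add: prime_dvd_power_iff)
  qed
  \<comment> \<open>\<open>fermat_theorem\<close> speaks of naturals, so it is applied to
    \<open>nat \<bar>x\<bar>\<close>; the even exponent \<open>q - 1\<close> then absorbs the
    absolute value.\<close>
  have fermat: "[x ^ (q - 1) = 1] (mod int q)" if "\<not> int q dvd x" for x :: int
  proof -
    have "[nat \<bar>x\<bar> ^ (q - 1) = 1] (mod q)"
      using that q(1) by (intro fermat_theorem) (auto simp flip: int_dvd_int_iff)
    then have "[\<bar>x\<bar> ^ (q - 1) = 1] (mod int q)"
      by (simp flip: cong_int_iff)
    moreover have "even (q - 1)" using q(2) by presburger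
    ultimately show ?thesis by (simp only: power_even_abs)
  qed
  \<comment> \<open>Oddness of \<open>m\<close>, which comes from q = 3 mod 4, lets the minus sign
    survive the power.\<close>
  define m where "m = (q - 1) div 2"
  have m: "odd m" "q - 1 = 2 * m" using q(2) unfolding m_def by presburger+
  have "[a\<^sup>2 = - (b\<^sup>2)] (mod int q)"
    using d by (simp add: cong_iff_dvd_diff)
  then have "[(a\<^sup>2) ^ m = (- (b\<^sup>2)) ^ m] (mod int q)" by (rule cong_pow)
  then have "[a ^ (q - 1) = - (b ^ (q - 1))] (mod int q)"
    using m by (simp add: power_mult)
  moreover have "[- (b ^ (q - 1)) = - 1] (mod int q)"
    using fermat[OF nb] by (simp add: cong_minus_minus_iff)
  ultimately have "[1 = (- 1 :: int)] (mod int q)"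
    using fermat[OF na] by (meson cong_sym cong_trans)
  then have "int q dvd int 2" by (simp add: cong_iff_dvd_diff)
  then have "q dvd 2" by (simp only: int_dvd_int_iff)
  then have "q \<le> 2" by (rule dvd_imp_le) simp
  with q(2) show False by (auto simp: le_Suc_eq numeral_2_eq_2)
qed

text \<open>In Gaussian terms: if \<open>p\<close> divides the real part of (a + bi)(c + di), a
  number of norm p^2, then it divides the whole product and the quotient is a unit. So c + di is the
  conjugate of a + bi up to a unit.\<close>

lemma prime_sum_two_squares_unique:
  fixes a b c d p :: int
  assumes p: "prime p" and ab: "a\<^sup>2 + b\<^sup>2 = p" and cd: "c\<^sup>2 + d\<^sup>2 = p"
  shows "a\<^sup>2 = c\<^sup>2 \<or> a\<^sup>2 = d\<^sup>2"
proof -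
  have p0: "p > 0" using p by (simp add: prime_gt_0_int)
  \<comment> \<open>The divisibility assumed here holds for \<open>d\<close> or for
    \<open>- d\<close>; the end of the proof chooses the sign.\<close>
  have *: "a\<^sup>2 = c\<^sup>2 \<or> a\<^sup>2 = d\<^sup>2"
    if cd: "c\<^sup>2 + d\<^sup>2 = p" and dv: "p dvd a * c - b * d" for c d :: int
  proof -
    have eq: "(a * c - b * d)\<^sup>2 + (a * d + b * c)\<^sup>2 = p\<^sup>2"
    proof -
      have "(a * c - b * d)\<^sup>2 + (a * d + b * c)\<^sup>2 = (a\<^sup>2 + b\<^sup>2) * (c\<^sup>2 + d\<^sup>2)"
        by (simp add: algebra_simps power2_eq_square)
      then show ?thesis by (simp add: ab cd power2_eq_square[of p])
    qed
    obtain k where k: "a * c - b * d = p * k" using dv by blast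
    have "p dvd (a * d + b * c)\<^sup>2"
    proof -
      have "(a * d + b * c)\<^sup>2 = p * (p - p * k\<^sup>2)"
        using eq unfolding k by (simp add: algebra_simps power2_eq_square)
      then show ?thesis by simp
    qed
    then have "p dvd a * d + b * c" using p by (simp add: prime_dvd_power_iff)
    then obtain l where l: "a * d + b * c = p * l" by blast
    have "p\<^sup>2 * (k\<^sup>2 + l\<^sup>2) = p\<^sup>2 * 1"
      using eq unfolding k l by (simp add: algebra_simps)
    then have kl: "k\<^sup>2 + l\<^sup>2 = 1" using p0 by simp
    have "k = 0 \<or> l = 0"
    proof (rule ccontr)
      assume "\<not> ?thesis"
      then have "k\<^sup>2 > 0" "l\<^sup>2 > 0" by auto
      with kl show False by linarith
    qed
    then show ?thesis
    proof
      assume "k = 0"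
      then have "a * c = b * d" using k by simp
      moreover have "(a\<^sup>2 + b\<^sup>2) * d\<^sup>2 - (c\<^sup>2 + d\<^sup>2) * a\<^sup>2 = (b * d - a * c) * (b * d + a * c)"
        by (simp add: algebra_simps power2_eq_square)
      ultimately have "p * d\<^sup>2 - p * a\<^sup>2 = 0" by (simp add: ab cd)
      then show ?thesis using p0 by simp
    next
      assume "l = 0"
      then have "a * d + b * c = 0" using l by simp
      moreover have "(a\<^sup>2 + b\<^sup>2) * c\<^sup>2 - (c\<^sup>2 + d\<^sup>2) * a\<^sup>2 = (b * c - a * d) * (a * d + b * c)"
        by (simp add: algebra_simps power2_eq_square)
      ultimately have "p * c\<^sup>2 - p * a\<^sup>2 = 0" by (simp add: ab cd)
      then show ?thesis using p0 by simp
    qed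
  qed
  \<comment> \<open>Both sums of squares on the right equal \<open>p\<close>, so \<open>p\<close>
    divides one of the two factors on the left.\<close>
  have "(a * c - b * d) * (a * c - b * (- d)) = a\<^sup>2 * (c\<^sup>2 + d\<^sup>2) - d\<^sup>2 * (a\<^sup>2 + b\<^sup>2)"
    by (simp add: algebra_simps power2_eq_square)
  then have "p dvd (a * c - b * d) * (a * c - b * (- d))" by (simp add: ab cd)
  then have "p dvd a * c - b * d \<or> p dvd a * c - b * (- d)"
    using p by (simp only: prime_dvd_mult_iff)
  then show ?thesis
    using *[of c d] *[of c "- d"] cd by auto
qed

text \<open>The condition on primes, with \<open>q = r\<close> allowed, passes to every divisor of
  \<open>n\<close>. The descent can therefore replace \<open>n\<close> by n/2 or n/q^2.\<close>

lemma sum_two_squares_unique: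
  fixes a b c d :: int and n :: nat
  assumes "n > 0"
    and "\<And>q r. prime q \<Longrightarrow> prime r \<Longrightarrow> q mod 4 = 1 \<Longrightarrow> r mod 4 = 1 \<Longrightarrow> \<not> q * r dvd n"
    and "a\<^sup>2 + b\<^sup>2 = int n" and "c\<^sup>2 + d\<^sup>2 = int n"
  shows "a\<^sup>2 = c\<^sup>2 \<or> a\<^sup>2 = d\<^sup>2"
  using assms
proof (induction n arbitrary: a b c d rule: less_induct)
  case (less n)
  note ab = less.prems(3) and cd = less.prems(4)
  consider (two) "even n"
    | (three) q where "prime q" "q mod 4 = 3" "q dvd n"
    | (one) "odd n" "\<And>q. prime q \<Longrightarrow> q dvd n \<Longrightarrow> q mod 4 \<noteq> 3" by blast
  then show ?case
  proof cases
    case two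
    then obtain m where m: "n = 2 * m" by blast
    have "even (a\<^sup>2 + b\<^sup>2)" "even (c\<^sup>2 + d\<^sup>2)" using ab cd m by simp_all
    then have "even (a + b)" "even (a - b)" "even (c + d)" "even (c - d)" by auto
    \<comment> \<open>Dividing a + bi by 1 + i, up to conjugation: half-sums and half-differences
      represent n/2.\<close>
    then obtain s t u w where st: "a + b = 2 * s" "a - b = 2 * t"
      and uw: "c + d = 2 * u" "c - d = 2 * w" by (elim dvdE) blast
    have ab_st: "a = s + t" "b = s - t" and cd_uw: "c = u + w" "d = u - w"
      using st uw by linarith+
    have "2 * (s\<^sup>2 + t\<^sup>2) = a\<^sup>2 + b\<^sup>2"
      unfolding ab_st by (simp add: algebra_simps power2_eq_square)
    then have 1: "s\<^sup>2 + t\<^sup>2 = int m" using ab m by simp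
    have "2 * (u\<^sup>2 + w\<^sup>2) = c\<^sup>2 + d\<^sup>2"
      unfolding cd_uw by (simp add: algebra_simps power2_eq_square)
    then have 2: "u\<^sup>2 + w\<^sup>2 = int m" using cd m by simp
    \<comment> \<open>The goal says that the left side vanishes, so a * b = c * d up to sign
      suffices. The two outcomes of the induction hypothesis supply the two signs.\<close>
    have *: "(a\<^sup>2 - c\<^sup>2) * (a\<^sup>2 - d\<^sup>2) = (c * d - a * b) * (c * d + a * b)"
    proof -
      have "(a\<^sup>2 - c\<^sup>2) * (a\<^sup>2 - d\<^sup>2) =
          a\<^sup>2 * (a\<^sup>2 + b\<^sup>2) - a\<^sup>2 * (c\<^sup>2 + d\<^sup>2) + (c * d - a * b) * (c * d + a * b)"
        by (simp add: algebra_simps power2_eq_square)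
      then show ?thesis by (simp add: ab cd)
    qed
    have "s\<^sup>2 = u\<^sup>2 \<or> s\<^sup>2 = w\<^sup>2"
    proof (rule less.IH[OF _ _ _ 1 2])
      show "m < n" "m > 0" using m less.prems(1) by simp_all
      show "\<not> q * r dvd m" if "prime q" "prime r" "q mod 4 = 1" "r mod 4 = 1" for q r
        using less.prems(2)[OF that] dvd_mult unfolding m by blast
    qed
    moreover have "(a\<^sup>2 - c\<^sup>2) * (a\<^sup>2 - d\<^sup>2) = 0" if "s\<^sup>2 = u\<^sup>2"
    proof -
      have "(a + b)\<^sup>2 = (c + d)\<^sup>2" using that st uw by (simp add: power_mult_distrib)
      then have "2 * (a * b) = 2 * (c * d)" using ab cd by (simp add: power2_sum)
      then have "a * b = c * d" by simp
      then show ?thesis using * by simp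
    qed
    moreover have "(a\<^sup>2 - c\<^sup>2) * (a\<^sup>2 - d\<^sup>2) = 0" if "s\<^sup>2 = w\<^sup>2"
    proof -
      have "(a + b)\<^sup>2 = (c - d)\<^sup>2" using that st uw by (simp add: power_mult_distrib)
      then have "2 * (a * b) = 2 * (- (c * d))"
        using ab cd by (simp add: power2_sum power2_diff)
      then have "a * b = - (c * d)" by simp
      then show ?thesis using * by simp
    qed
    ultimately show ?thesis by auto
  next
    case three
    then have "int q dvd a\<^sup>2 + b\<^sup>2" "int q dvd c\<^sup>2 + d\<^sup>2" using ab cd by simp_all
    moreover from this have "int q dvd b\<^sup>2 + a\<^sup>2" "int q dvd d\<^sup>2 + c\<^sup>2" by (simp_all add: add.commute)
    \<comment> \<open>Since \<open>q\<close> divides all four numbers, both representations can be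
      divided by \<open>q\<close>, and \<open>n\<close> by its square.\<close>
    ultimately have "int q dvd a" "int q dvd b" "int q dvd c" "int q dvd d"
      using prime_3_mod_4_dvd_sum_squares three(1,2) by blast+
    then obtain s t u w where st: "a = int q * s" "b = int q * t"
      and uw: "c = int q * u" "d = int q * w" by (elim dvdE) blast
    have q0: "q > 1" using three(1) by (rule prime_gt_1_nat)
    have "int (q\<^sup>2) * (s\<^sup>2 + t\<^sup>2) = int n"
      using ab unfolding st by (simp add: algebra_simps)
    then have "int (q\<^sup>2) dvd int n" by (metis dvd_triv_left)
    then have "q\<^sup>2 dvd n" by (simp only: int_dvd_int_iff)
    then obtain m where m: "n = q\<^sup>2 * m" by blast
    have "int (q\<^sup>2) * (s\<^sup>2 + t\<^sup>2) = int (q\<^sup>2) * int m"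
      using ab unfolding st m by (simp add: algebra_simps)
    then have 1: "s\<^sup>2 + t\<^sup>2 = int m" using q0 by simp
    have "int (q\<^sup>2) * (u\<^sup>2 + w\<^sup>2) = int (q\<^sup>2) * int m"
      using cd unfolding uw m by (simp add: algebra_simps)
    then have 2: "u\<^sup>2 + w\<^sup>2 = int m" using q0 by simp
    have "s\<^sup>2 = u\<^sup>2 \<or> s\<^sup>2 = w\<^sup>2"
    proof (rule less.IH[OF _ _ _ 1 2])
      show m0: "m > 0" using m less.prems(1) by simp
      have "1 < q\<^sup>2" using q0 by (intro one_less_power) simp_all
      then show "m < n" using m0 unfolding m by simp
      show "\<not> q * r dvd m" if "prime q" "prime r" "q mod 4 = 1" "r mod 4 = 1" for q r
        using less.prems(2)[OF that] dvd_mult unfolding m by blast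
    qed
    then show ?thesis unfolding st uw by (auto simp: power_mult_distrib)
  next
    case one
    \<comment> \<open>Only primes 1 mod 4 remain, and no two of them (even equal) may occur
      together, so \<open>n\<close> is 1 or prime.\<close>
    have p1: "q mod 4 = 1" if "prime q" "q dvd n" for q
    proof -
      have "odd q" using one(1) that(2) by (meson dvd_trans)
      then show ?thesis using one(2)[OF that] by presburger
    qed
    show ?thesis
    proof (cases "n = 1")
      case True
      have *: "x\<^sup>2 = 0 \<or> x\<^sup>2 = 1" if "x\<^sup>2 + y\<^sup>2 = 1" for x y :: int
      proof -
        have "0 \<le> x\<^sup>2" "0 \<le> y\<^sup>2" by simp_all
        with that show ?thesis by linarith
      qed
      show ?thesis using *[of a b] *[of c d] ab cd True by auto
    next
      case False
      then obtain p where p: "prime p" "p dvd n" using prime_factor_nat by blast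
      then obtain m where m: "n = p * m" by blast
      have "m = 1"
      proof (rule ccontr)
        assume "m \<noteq> 1"
        then obtain r where r: "prime r" "r dvd m" using prime_factor_nat by blast
        then have "p * r dvd n" "r dvd n" unfolding m by auto
        then show False using less.prems(2) p r p1 by blast
      qed
      then have "prime (int n)" using m p by simp
      then show ?thesis using ab cd by (rule prime_sum_two_squares_unique)
    qed
  qed
qed

section \<open>Autocorrelations and signed sums\<close>

lemma sum_shift_mod:
  fixes f :: "nat \<Rightarrow> 'a :: comm_monoid_add"
  shows "(\<Sum>k<v. f ((k + s) mod v)) = (\<Sum>k<v. f k)"
proof (cases "v = 0")
  case False
  have "inj_on (\<lambda>k. (k + s) mod v) {..<v}"
  proof (rule inj_onI)
    fix x y assume "x \<in> {..<v}" "y \<in> {..<v}" "(x + s) mod v = (y + s) mod v"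
    then have "[x + s = y + s] (mod v)" by (simp add: cong_def)
    then have "[x = y] (mod v)" by (simp only: cong_add_rcancel_nat)
    then show "x = y" using \<open>x \<in> {..<v}\<close> \<open>y \<in> {..<v}\<close> by (simp add: cong_def)
  qed
  moreover have "(\<lambda>k. (k + s) mod v) ` {..<v} \<subseteq> {..<v}" using False by auto
  ultimately have "bij_betw (\<lambda>k. (k + s) mod v) {..<v} {..<v}"
    by (simp add: bij_betw_def endo_inj_surj)
  then show ?thesis by (rule sum.reindex_bij_betw)
qed simp

lemma PAF_symmetric:
  assumes "s \<le> length A"
  shows "PAF A (length A - s) = PAF A s"
proof -
  let ?v = "length A"
  let ?f = "\<lambda>k. A ! k * A ! ((k + (?v - s)) mod ?v)"
  have "PAF A (?v - s) = (\<Sum>k<?v. ?f ((k + s) mod ?v))"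
    unfolding PAF_def by (rule sum_shift_mod[symmetric])
  also have "\<dots> = PAF A s"
    unfolding PAF_def
  proof (rule sum.cong[OF refl])
    fix k assume "k \<in> {..<?v}"
    then have "(k + s + (?v - s)) mod ?v = k"
      using assms by simp
    then have "((k + s) mod ?v + (?v - s)) mod ?v = k"
      by (simp only: mod_add_left_eq)
    then show "?f ((k + s) mod ?v) = A ! k * A ! ((k + s) mod ?v)" by simp
  qed
  finally show ?thesis .
qed

text \<open>Even \<open>v\<close> makes k -> e^k well defined on residues modulo \<open>v\<close>,
  that is, a real character of the cyclic group.\<close>

lemma sign_power_mod_even:
  fixes e :: int
  assumes "e = 1 \<or> e = - 1" "even v"
  shows "e ^ (n mod v) = e ^ n"
proof -
  have "even (n mod v) \<longleftrightarrow> even n" using assms(2) by (simp add: dvd_mod_iff)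
  then show ?thesis using assms(1) by (auto simp: minus_one_power_iff)
qed

text \<open>The Wiener-Khinchin identity at a real character: the squared Fourier coefficient of
  \<open>A\<close> is the Fourier coefficient of its autocorrelation.\<close>

lemma signed_sum_square_PAF:
  fixes e :: int
  assumes e: "e = 1 \<or> e = - 1" and v: "even (length A)"
  shows "(\<Sum>k<length A. e ^ k * A ! k)\<^sup>2 = (\<Sum>s<length A. e ^ s * PAF A s)"
proof -
  let ?v = "length A"
  have "(\<Sum>s<?v. e ^ s * PAF A s) = (\<Sum>s<?v. \<Sum>k<?v. e ^ s * (A ! k * A ! ((k + s) mod ?v)))"
    unfolding PAF_def by (simp add: sum_distrib_left)
  also have "\<dots> = (\<Sum>k<?v. \<Sum>s<?v. e ^ s * (A ! k * A ! ((k + s) mod ?v)))"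
    by (rule sum.swap)
  also have "\<dots> = (\<Sum>k<?v. \<Sum>s<?v. (e ^ k * A ! k) * (e ^ ((s + k) mod ?v) * A ! ((s + k) mod ?v)))"
  proof (intro sum.cong refl)
    fix k s
    \<comment> \<open>As e^k is its own inverse, e^s splits into one sign for each of the two
      entries.\<close>
    have "e ^ k * e ^ k = 1" using e by (auto simp flip: power_mult_distrib)
    then have "e ^ s = e ^ k * e ^ ((s + k) mod ?v)"
      unfolding sign_power_mod_even[OF e v] by (simp add: power_add algebra_simps)
    then show "e ^ s * (A ! k * A ! ((k + s) mod ?v)) =
        (e ^ k * A ! k) * (e ^ ((s + k) mod ?v) * A ! ((s + k) mod ?v))"
      by (simp add: add.commute mult_ac)
  qed
  also have "\<dots> = (\<Sum>k<?v. (e ^ k * A ! k) * (\<Sum>j<?v. e ^ j * A ! j))"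
    unfolding sum_distrib_left[symmetric]
    by (subst sum_shift_mod[where f = "\<lambda>j. e ^ j * A ! j"]) (rule refl)
  also have "\<dots> = (\<Sum>k<?v. e ^ k * A ! k)\<^sup>2"
    by (simp add: power2_eq_square sum_distrib_right)
  finally show ?thesis by simp
qed

text \<open>The definition covers lags up to v/2; the reflection s -> v - s reaches the
  others.\<close>

lemma periodic_Golay_pair_PAF:
  assumes "periodic_Golay_pair v A B" "0 < s" "s < v"
  shows "PAF A s + PAF B s = 0"
proof -
  have l: "length A = v" "length B = v"
    and z: "\<And>s. 1 \<le> s \<Longrightarrow> s \<le> v div 2 \<Longrightarrow> PAF A s + PAF B s = 0"
    using assms(1) by (auto simp: periodic_Golay_pair_def)
  show ?thesis
  proof (cases "s \<le> v div 2")
    case False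
    then have "PAF A (v - s) + PAF B (v - s) = 0" using assms(2,3) by (intro z) auto
    then show ?thesis using PAF_symmetric[of s A] PAF_symmetric[of s B] l assms(3) by simp
  qed (use z assms(2) in auto)
qed

lemma PAF_0_sign:
  assumes "set A \<subseteq> {- 1, 1}"
  shows "PAF A 0 = int (length A)"
proof -
  have "A ! k * A ! (k mod length A) = 1" if "k < length A" for k
  proof -
    have "A ! k \<in> {- 1, 1}" using nth_mem[OF that] assms by blast
    then show ?thesis using that by auto
  qed
  then show ?thesis by (simp add: PAF_def)
qed

text \<open>In the sum over lags only lag 0 survives, where each sequence contributes
  \<open>v\<close>.\<close>

lemma periodic_Golay_pair_signed_sums:
  fixes e :: int
  assumes G: "periodic_Golay_pair v A B" and v: "v > 0" "even v" and e: "e = 1 \<or> e = - 1"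
  shows "(\<Sum>k<v. e ^ k * A ! k)\<^sup>2 + (\<Sum>k<v. e ^ k * B ! k)\<^sup>2 = int (2 * v)"
proof -
  have l: "length A = v" "length B = v" and s: "set A \<subseteq> {- 1, 1}" "set B \<subseteq> {- 1, 1}"
    using G by (auto simp: periodic_Golay_pair_def)
  have "(\<Sum>k<v. e ^ k * A ! k)\<^sup>2 + (\<Sum>k<v. e ^ k * B ! k)\<^sup>2
      = (\<Sum>s<v. e ^ s * (PAF A s + PAF B s))"
    using signed_sum_square_PAF[OF e, of A] signed_sum_square_PAF[OF e, of B] l v
    by (simp add: sum.distrib distrib_left)
  also have "\<dots> = (\<Sum>s\<in>{0}. e ^ s * (PAF A s + PAF B s))"
    using v periodic_Golay_pair_PAF[OF G] by (intro sum.mono_neutral_right) auto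
  also have "\<dots> = int (2 * v)" using PAF_0_sign[OF s(1)] PAF_0_sign[OF s(2)] l by simp
  finally show ?thesis .
qed

section \<open>Compressions of length two and their equivalence\<close>

text \<open>The two entries collect the even and the odd positions of \<open>A\<close>, so their sum
  and difference are the two signed sums above.\<close>

lemma half_compression:
  assumes "length A = v" "v > 0" "even v"
  obtains x y where "compression (v div 2) A = [x, y]"
    "x + y = (\<Sum>k<v. A ! k)" "x - y = (\<Sum>k<v. (- 1) ^ k * A ! k)"
proof -
  obtain n where n: "v = 2 * n" using assms(3) by blast
  have "n > 0" using assms(2) n by simp
  let ?x = "\<Sum>j<n. A ! (2 * j)" and ?y = "\<Sum>j<n. A ! (2 * j + 1)"
  have *: "(\<Sum>k<2 * n. f k) = (\<Sum>j<n. f (2 * j)) + (\<Sum>j<n. f (2 * j + 1))"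
    for f :: "nat \<Rightarrow> int" and n
    by (induction n) auto
  show thesis
  proof (rule that)
    show "compression (v div 2) A = [?x, ?y]"
    proof -
      have "length A div n = 2" "v div 2 = n" using assms(1) n \<open>n > 0\<close> by simp_all
      moreover have "[0..<2] = [0, 1]" by (simp add: numeral_2_eq_2)
      ultimately show ?thesis by (simp add: compression_def mult.commute)
    qed
    show "?x + ?y = (\<Sum>k<v. A ! k)"
      unfolding n * ..
    show "?x - ?y = (\<Sum>k<v. (- 1) ^ k * A ! k)"
      unfolding n * by (simp add: sum_negf)
  qed
qed

text \<open>On two entries a cyclic shift by 1 is the transposition, and each sequence may be
  shifted on its own.\<close>

lemma pair_equivalent_length_2:
  assumes "[x, y] = [x', y'] \<or> [x, y] = [y', x']" "[z, w] = [z', w'] \<or> [z, w] = [w', z']"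
  shows "pair_equivalent ([x, y], [z, w]) ([x', y'], [z', w'])"
proof -
  have 1: "pair_op ([x, y], [z, w]) ([y, x], [z, w])" for x y z w
    using shift_fst[of "[x, y]" "[z, w]" 1] by simp
  have 2: "pair_op ([x, y], [z, w]) ([x, y], [w, z])" for x y z w
    using shift_snd[of "[x, y]" "[z, w]" 1] by simp
  have "equivclp pair_op ([x, y], [z, w]) ([x', y'], [z, w])"
    using assms(1) 1[of x y z w] by (auto intro: r_into_equivclp)
  moreover have "equivclp pair_op ([x', y'], [z, w]) ([x', y'], [z', w'])"
    using assms(2) 2[of x' y' z w] by (auto intro: r_into_equivclp)
  ultimately show ?thesis
    unfolding pair_equivalent_def by (rule equivclp_trans)
qed

section \<open>From the condition on v/2 to the two normal forms\<close>

text \<open>Restates the condition in the form the descent uses. In the second alternative both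
  primes equal \<open>p\<close>, and then p^2 would divide \<open>n\<close> against its
  multiplicity.\<close>

lemma no_two_primes_1_mod_4:
  fixes n q r :: nat
  assumes "n > 0"
    and "(\<not> (\<exists>p. prime p \<and> [p = 1] (mod 4) \<and> p dvd n)) \<or>
         (\<exists>p. prime p \<and> [p = 1] (mod 4) \<and> multiplicity p n = 1 \<and>
              (\<forall>q. prime q \<and> [q = 1] (mod 4) \<and> q dvd n \<longrightarrow> q = p))"
    and qr: "prime q" "prime r" "q mod 4 = 1" "r mod 4 = 1"
  shows "\<not> q * r dvd n"
proof
  assume d: "q * r dvd n"
  then have "q dvd n" "r dvd n" by (auto dest: dvd_mult_left dvd_mult_right)
  moreover have "[q = 1] (mod 4)" "[r = 1] (mod 4)" using qr by (simp_all add: cong_def)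
  ultimately obtain p where p: "multiplicity p n = 1" "q = p" "r = p"
    using assms(2) qr(1,2) by blast
  then have "p ^ 2 dvd n" using d by (simp add: power2_eq_square)
  then have "2 \<le> multiplicity p n"
    using assms(1) qr(1) p(2) by (intro multiplicity_geI) (auto simp: prime_gt_1_nat)
  with p(1) show False by simp
qed

theorem mainTheorem5:
  fixes v :: nat and A B :: "int list" and a b :: int
  assumes "v > 0" and "even v"
    and "periodic_Golay_pair v A B"
    and "a = sum_list A" and "b = sum_list B"
    and "(\<not> (\<exists>p. prime p \<and> [p = 1] (mod 4) \<and> p dvd v div 2)) \<or>
         (\<exists>p. prime p \<and> [p = 1] (mod 4) \<and> multiplicity p (v div 2) = 1 \<and>
              (\<forall>q. prime q \<and> [q = 1] (mod 4) \<and> q dvd v div 2 \<longrightarrow> q = p))"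
  shows "pair_equivalent (compression (v div 2) A, compression (v div 2) B) ([0, a], [0, b]) \<or>
         pair_equivalent (compression (v div 2) A, compression (v div 2) B)
           ([(a + b) div 2, (a - b) div 2], [(a + b) div 2, (b - a) div 2])"
proof -
  have l: "length A = v" "length B = v"
    using assms(3) by (auto simp: periodic_Golay_pair_def)
  have ab: "a = (\<Sum>k<v. A ! k)" "b = (\<Sum>k<v. B ! k)"
    using assms(4,5) l by (simp_all add: sum_list_sum_nth atLeast0LessThan)
  obtain x0 x1 where x: "compression (v div 2) A = [x0, x1]"
    "x0 + x1 = a" "x0 - x1 = (\<Sum>k<v. (- 1) ^ k * A ! k)"
    using half_compression[OF l(1) assms(1,2)] ab by metis
  obtain y0 y1 where y: "compression (v div 2) B = [y0, y1]"
    "y0 + y1 = b" "y0 - y1 = (\<Sum>k<v. (- 1) ^ k * B ! k)"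
    using half_compression[OF l(2) assms(1,2)] ab by metis
  have 1: "a\<^sup>2 + b\<^sup>2 = int (2 * v)"
    using periodic_Golay_pair_signed_sums[OF assms(3,1,2), of 1] ab by simp
  have 2: "(x0 - x1)\<^sup>2 + (y0 - y1)\<^sup>2 = int (2 * v)"
    using periodic_Golay_pair_signed_sums[OF assms(3,1,2), of "- 1"] x y by simp
  \<comment> \<open>The number represented is 2v = 4(v/2), and the factor 4 is coprime to the odd
    \<open>q\<close> and \<open>r\<close>.\<close>
  have "\<not> q * r dvd 2 * v" if qr: "prime q" "prime r" "q mod 4 = 1" "r mod 4 = 1" for q r
  proof
    assume "q * r dvd 2 * v"
    moreover have "2 * v = 2 ^ 2 * (v div 2)" using assms(2) by simp
    ultimately have "q * r dvd 2 ^ 2 * (v div 2)" by metis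
    moreover have "odd q" "odd r" using qr(3,4) by presburger+
    then have "coprime (q * r) (2 ^ 2)"
      unfolding coprime_power_right_iff coprime_right_2_iff_odd by simp
    ultimately have "q * r dvd v div 2" by (simp only: coprime_dvd_mult_right_iff)
    moreover have "v div 2 > 0" using assms(1,2) by auto
    ultimately show False using no_two_primes_1_mod_4[OF _ assms(6) qr] by blast
  qed
  then have "a\<^sup>2 = (x0 - x1)\<^sup>2 \<or> a\<^sup>2 = (y0 - y1)\<^sup>2"
    using assms(1) by (intro sum_two_squares_unique[OF _ _ 1 2]) auto
  then show ?thesis
  proof
    assume *: "a\<^sup>2 = (x0 - x1)\<^sup>2"
    then have "b\<^sup>2 = (y0 - y1)\<^sup>2" using 1 2 by simp
    \<comment> \<open>A sum and a difference of two integers agree up to sign only if one of the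
      integers is 0.\<close>
    then have "x0 = 0 \<or> x1 = 0" "y0 = 0 \<or> y1 = 0"
      using * x(2) y(2) unfolding power2_eq_iff by auto
    then have "pair_equivalent ([x0, x1], [y0, y1]) ([0, a], [0, b])"
      using x(2) y(2) by (intro pair_equivalent_length_2) auto
    then show ?thesis using x(1) y(1) by simp
  next
    assume *: "a\<^sup>2 = (y0 - y1)\<^sup>2"
    then have "b\<^sup>2 = (x0 - x1)\<^sup>2" using 1 2 by simp
    \<comment> \<open>Crossed matching: \<open>a\<close> and \<open>b\<close> are now the sum and,
      up to sign, the difference of \<open>x0\<close> and \<open>x1\<close>, and likewise
      \<open>b\<close> and \<open>a\<close> for \<open>y0\<close> and \<open>y1\<close>.\<close>
    then have ay: "a = y0 - y1 \<or> a = y1 - y0" and bx: "b = x0 - x1 \<or> b = x1 - x0"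
      using * unfolding power2_eq_iff by auto
    \<comment> \<open>Shows that \<open>div 2\<close> is exact here: each numerator is twice an
      entry.\<close>
    have half: "s = (s + t + (s - t)) div 2" for s t :: int by simp
    have "[x0, x1] = [(a + b) div 2, (a - b) div 2] \<or> [x0, x1] = [(a - b) div 2, (a + b) div 2]"
      using bx half[of x0 x1] half[of x1 x0] unfolding x(2)[symmetric] by (elim disjE) simp_all
    moreover have "[y0, y1] = [(a + b) div 2, (b - a) div 2] \<or> [y0, y1] = [(b - a) div 2, (a + b) div 2]"
      using ay half[of y0 y1] half[of y1 y0] unfolding y(2)[symmetric] by (elim disjE) simp_all
    ultimately have "pair_equivalent ([x0, x1], [y0, y1])
        ([(a + b) div 2, (a - b) div 2], [(a + b) div 2, (b - a) div 2])"
      by (rule pair_equivalent_length_2)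
    then show ?thesis using x(1) y(1) by simp
  qed
qed

end
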